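(* Let $n\ge 1$, let $P(z)$ be a polynomial of degree $n$ with complex coefficients, and let $Q(z)=z^n\overline{P(1/\overline{z})}$. Let $a\in\mathbb{C}$ with $|a|\le 1$. Then for all $\alpha,\beta\in\mathbb{C}$ with $|\alpha|\le 1$, $|\beta|\le 1$, every real $R\ge 1$, and every $z\in\mathbb{C}$ with $|z|\ge 1$, $$\left|\tilde{\mathbb{S}}_a[P](Rz)-\alpha\,\tilde{\mathbb{S}}_a[P](z)+\beta\left\{\left(\tfrac{R+1}{2}\right)^n-|\alpha|\right\}\tilde{\mathbb{S}}_a[P](z)\right|+\left|\tilde{\mathbb{S}}_a[Q](Rz)-\alpha\,\tilde{\mathbb{S}}_a[Q](z)+\beta\left\{\left(\tfrac{R+1}{2}\right)^n-|\alpha|\right\}\tilde{\mathbb{S}}_a[Q](z)\right|$$ $$\le\left[\left|R^n-\alpha+\beta\left\{\left(\tfrac{R+1}{2}\right)^n-|\alpha|\right\}\right|\bigl|\tilde{\mathbb{S}}_a[z^n]\bigr|+\left|1-\alpha+\beta\left\{\left(\tfrac{R+1}{2}\right)^n-|\alpha|\right\}\right|n|a|\right]\max_{|\zeta|=1}|P(\zeta)|.$$ The result is sharp: equality holds for $P(z)=\lambda z^n$, $\lambda\in\mathbb{C}$, $\lambda\neq0$.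
   Context: For a fixed integer $n\ge 1$, a number $a\in\mathbb{C}$ with $|a|\le 1$, and a polynomial $P$ of degree at most $n$, the modified Smirnov operator is $\tilde{\mathbb{S}}_a[P](z)=(1+az)P'(z)-naP(z)$; the same $n=\deg P$ is used for $Q$, even if $Q$ has smaller degree. The symbol $\tilde{\mathbb{S}}_a[P](Rz)$ denotes the operator applied to the polynomial $z\mapsto P(Rz)$ and evaluated at $z$, i.e. $\tilde{\mathbb{S}}_a[P](Rz)=(1+az)\,R\,P'(Rz)-na\,P(Rz)$, and similarly for $Q$. The symbol $\tilde{\mathbb{S}}_a[z^n]$ denotes the operator applied to the monomial $z^n$, evaluated at $z$, i.e. $\tilde{\mathbb{S}}_a[z^n]=nz^{n-1}$. The polynomial $Q(z)=z^n\overline{P(1/\overline z)}$ is the one obtained from $P(z)=\sum_{j=0}^n c_jz^j$ as $Q(z)=\sum_{j=0}^n\overline{c_{n-j}}z^j$. *)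

theory Defs
  imports "HOL-Analysis.Analysis" "HOL-Computational_Algebra.Polynomial"
begin

text \<open>The parameter \<open>n\<close> is explicit: the same \<open>n\<close> is used for polynomials of
  degree less than \<open>n\<close>.\<close>

definition smirnov :: "nat \<Rightarrow> complex \<Rightarrow> complex poly \<Rightarrow> complex poly" where
  "smirnov n a P = [:1, a:] * pderiv P - smult (of_nat n * a) P"

lemma poly_smirnov:
  "poly (smirnov n a P) z = (1 + a * z) * poly (pderiv P) z - of_nat n * a * poly P z"
  by (simp add: smirnov_def algebra_simps)

definition dilate :: "real \<Rightarrow> complex poly \<Rightarrow> complex poly" where
  "dilate R P = pcompose P [:0, of_real R:]"

lemma poly_dilate: "poly (dilate R P) z = poly P (of_real R * z)"
  by (simp add: dilate_def poly_pcompose mult.commute)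

lemma poly_smirnov_dilate:
  "poly (smirnov n a (dilate R P)) z =
     (1 + a * z) * of_real R * poly (pderiv P) (of_real R * z)
       - of_nat n * a * poly P (of_real R * z)"
  by (simp add: poly_smirnov poly_dilate)
     (simp add: dilate_def pderiv_pcompose poly_pcompose pderiv_pCons algebra_simps)

definition conj_recip :: "nat \<Rightarrow> complex poly \<Rightarrow> complex poly" where
  "conj_recip n P = (\<Sum>j\<le>n. monom (cnj (coeff P (n - j))) j)"

lemma poly_conj_recip:
  assumes "degree P \<le> n" "z \<noteq> 0"
  shows "poly (conj_recip n P) z = z ^ n * cnj (poly P (1 / cnj z))"
proof -
  have "poly P (1 / cnj z) = (\<Sum>j\<le>n. coeff P j * (1 / cnj z) ^ j)"
    unfolding poly_altdef using assms(1)
    by (intro sum.mono_neutral_left) (auto simp: coeff_eq_0)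
  then have "z ^ n * cnj (poly P (1 / cnj z)) = (\<Sum>j\<le>n. cnj (coeff P j) * (z ^ n * (1 / z) ^ j))"
    by (simp add: sum_distrib_left mult_ac)
  also have "\<dots> = (\<Sum>j\<le>n. cnj (coeff P j) * z ^ (n - j))"
    using assms(2) by (intro sum.cong) (auto simp: power_diff power_divide)
  also have "\<dots> = (\<Sum>j\<le>n. cnj (coeff P (n - j)) * z ^ j)"
    by (rule sum.reindex_bij_witness[of _ "\<lambda>j. n - j" "\<lambda>j. n - j"]) auto
  finally show ?thesis
    by (simp add: conj_recip_def poly_sum poly_monom)
qed

definition circle_max :: "complex poly \<Rightarrow> real" where
  "circle_max P = (SUP w\<in>sphere 0 1. cmod (poly P w))"

text \<open>The supremum is a maximum.\<close>

lemma circle_max_attained: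
  "\<exists>w. cmod w = 1 \<and> cmod (poly P w) = circle_max P"
  "cmod w = 1 \<Longrightarrow> cmod (poly P w) \<le> circle_max P"
proof -
  let ?f = "\<lambda>w. cmod (poly P w)"
  have "continuous_on (sphere 0 1) ?f"
    by (intro continuous_intros)
  then obtain x where x: "x \<in> sphere 0 1" "\<And>y. y \<in> sphere 0 1 \<Longrightarrow> ?f y \<le> ?f x"
    using continuous_attains_sup[of "sphere 0 1" ?f] compact_sphere by fastforce
  then have eq: "circle_max P = ?f x"
    unfolding circle_max_def by (intro cSup_eq_maximum) auto
  show "\<exists>w. cmod w = 1 \<and> cmod (poly P w) = circle_max P"
    using x(1) eq by auto
  show "cmod w = 1 \<Longrightarrow> cmod (poly P w) \<le> circle_max P"
    using x(2)[of w] eq by simp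
qed

end

theory Submission
  imports Defs "HOL-Complex_Analysis.Complex_Analysis"
begin

text \<open>With \<open>g = \<beta> (((R + 1) / 2)\<^sup>n - |\<alpha>|) - \<alpha>\<close>, the expressions in the theorem are the
  values of the linear operator \<open>L P = S\<^sub>a (P(R \<sqdot>) + g P)\<close>. If \<open>P\<close> has degree \<open>n\<close> and all its zeros
  in the open unit disc, then \<open>|P(R z)| > ((R + 1) / 2)\<^sup>n |P z| \<ge> |g| |P z|\<close> for \<open>R > 1\<close>,
  \<open>|z| \<ge> 1\<close>, so \<open>P(R \<sqdot>) + g P\<close> again has all its zeros in the disc, and by the argument of
  Laguerre's theorem \<open>L P\<close> does not vanish outside it. Consequently \<open>|F| \<le> |G|\<close> on the circle
  implies \<open>|L F| \<le> |L G|\<close> outside the disc whenever \<open>G\<close> has degree \<open>n\<close> and all zeros in the disc: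
  otherwise \<open>L (G - \<mu> F)\<close> would have a zero there for some \<open>|\<mu>| < 1\<close>. This is applied to
  \<open>Q\<close> and \<open>M z\<^sup>n\<close>, where \<open>M = max |P|\<close> on the circle, and to \<open>P + c\<close> and its reciprocal
  \<open>Q + cnj c z\<^sup>n\<close> with \<open>|c| = t M\<close>, \<open>t > 1\<close>. The argument of \<open>c\<close> is chosen so that
  \<open>|L Q + cnj c L z\<^sup>n| = |c| |L z\<^sup>n| - |L Q|\<close>; finally \<open>t\<close> tends to \<open>1\<close>.\<close>

section \<open>Growth of a polynomial under dilation\<close>

lemma degree_linear_mult:
  fixes q :: "'a::idom poly"
  assumes "q \<noteq> 0"
  shows "degree ([:-w, 1:] * q) = Suc (degree q)"
  using assms by (subst degree_mult_eq) auto

text \<open>Splitting off one linear factor at a time lets both the growth estimate and the formula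
  for the logarithmic derivative be proved by induction over the zeros.\<close>

lemma complex_poly_root_induct [consumes 1, case_names const root]:
  fixes p :: "complex poly"
  assumes "p \<noteq> 0"
    and "\<And>c. c \<noteq> 0 \<Longrightarrow> Q [:c:]"
    and "\<And>w q. q \<noteq> 0 \<Longrightarrow> Q q \<Longrightarrow> Q ([:-w, 1:] * q)"
  shows "Q p"
  using assms(1)
proof (induction "degree p" arbitrary: p)
  case 0
  then obtain c where "p = [:c:]"
    by (metis degree_eq_zeroE)
  with 0 assms(2) show ?case
    by auto
next
  case (Suc m)
  then have "\<exists>i\<in>{1..degree p}. coeff p i \<noteq> 0"
    by (intro bexI[of _ "degree p"]) auto
  then obtain w where "poly p w = 0"
    unfolding poly_altdef using fundamental_theorem_of_algebra by metis
  then obtain q where q: "p = [:-w, 1:] * q"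
    by (auto simp: poly_eq_0_iff_dvd)
  with \<open>p \<noteq> 0\<close> have "q \<noteq> 0"
    by auto
  moreover have "degree p = Suc (degree q)"
    unfolding q using \<open>q \<noteq> 0\<close> by (rule degree_linear_mult)
  ultimately show ?case
    using Suc assms(3) q by auto
qed

lemma cmod_dilate_linear_less:
  fixes z w :: complex
  assumes "cmod w < cmod z" "R > 1"
  shows "(R + 1) / 2 * cmod (z - w) < cmod (of_real R * z - w)"
proof -
  define k where "k = (R + 1) / 2"
  have k: "k > 1" "R = 2 * k - 1"
    using assms by (auto simp: k_def field_simps)
  \<comment> \<open>This expands \<open>R z - w = k (z - w) + (k - 1) (z + w)\<close>; the cross
    term is a multiple of \<open>Re ((z - w) * cnj (z + w))\<close>, which equals
    \<open>|z|^2 - |w|^2\<close>.\<close>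
  have sq: "(cmod (of_real R * z - w))\<^sup>2 = (k * cmod (z - w))\<^sup>2 + (k - 1)\<^sup>2 * (cmod (z + w))\<^sup>2
      + 2 * k * (k - 1) * ((cmod z)\<^sup>2 - (cmod w)\<^sup>2)"
    unfolding k(2) power_mult_distrib cmod_power2 by simp algebra
  have "(cmod w)\<^sup>2 < (cmod z)\<^sup>2"
    using assms by (intro power_strict_mono) auto
  then have "2 * k * (k - 1) * ((cmod z)\<^sup>2 - (cmod w)\<^sup>2) > 0"
    using k by simp
  then have "(k * cmod (z - w))\<^sup>2 < (cmod (of_real R * z - w))\<^sup>2"
    unfolding sq by (smt (verit) mult_nonneg_nonneg zero_le_power2)
  then show ?thesis
    unfolding k_def by (rule power2_less_imp_less) auto
qed

text \<open>Multiply the estimates for the linear factors. Both forms are proved together: a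
  constant gives only equality, while each linear factor contributes a strict inequality.\<close>

lemma cmod_dilate_ge:
  assumes "p \<noteq> 0" "\<And>w. poly p w = 0 \<Longrightarrow> cmod w < cmod z" "R > 1"
  shows "((R + 1) / 2) ^ degree p * cmod (poly p z) \<le> cmod (poly p (of_real R * z))"
    and "degree p > 0 \<Longrightarrow>
      ((R + 1) / 2) ^ degree p * cmod (poly p z) < cmod (poly p (of_real R * z))"
proof -
  let ?k = "(R + 1) / 2"
  have "?k ^ degree p * cmod (poly p z) \<le> cmod (poly p (of_real R * z)) \<and>
    (degree p > 0 \<longrightarrow> ?k ^ degree p * cmod (poly p z) < cmod (poly p (of_real R * z)))"
    using assms(1,2)
  proof (induction rule: complex_poly_root_induct)
    case (root w q)
    have le: "?k ^ degree q * cmod (poly q z) \<le> cmod (poly q (of_real R * z))"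
      using root by auto
    \<comment> \<open>A strict factor keeps the product strict only if the other factor is positive;
      \<open>z\<close> itself is no zero, since zeros have modulus less than
      \<open>cmod z\<close>.\<close>
    have "poly q z \<noteq> 0"
      using root.prems[of z] by auto
    then have pos: "0 < ?k ^ degree q * cmod (poly q z)"
      using \<open>R > 1\<close> by simp
    have "?k * cmod (z - w) < cmod (of_real R * z - w)"
      using root.prems[of w] \<open>R > 1\<close> by (intro cmod_dilate_linear_less) auto
    then have "(?k * cmod (z - w)) * (?k ^ degree q * cmod (poly q z))
        < cmod (of_real R * z - w) * cmod (poly q (of_real R * z))"
      using le pos \<open>R > 1\<close> by (intro mult_less_le_imp_less) auto
    moreover have "(?k * cmod (z - w)) * (?k ^ degree q * cmod (poly q z))
        = ?k ^ degree ([:-w, 1:] * q) * cmod (poly ([:-w, 1:] * q) z)"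
      unfolding degree_linear_mult[OF root.hyps(1)] poly_mult norm_mult by simp
    moreover have "cmod (of_real R * z - w) * cmod (poly q (of_real R * z))
        = cmod (poly ([:-w, 1:] * q) (of_real R * z))"
      unfolding poly_mult norm_mult by simp
    ultimately show ?case
      by linarith
  qed auto
  then show "?k ^ degree p * cmod (poly p z) \<le> cmod (poly p (of_real R * z))"
    and "degree p > 0 \<Longrightarrow> ?k ^ degree p * cmod (poly p z) < cmod (poly p (of_real R * z))"
    by auto
qed

section \<open>Laguerre's argument for the Smirnov operator\<close>

text \<open>If \<open>u = 1 / (z - v)\<close>, then \<open>z * u - 1 = v * u\<close>, so this set is
  the image of the open unit disc under \<open>v \<mapsto> 1 / (z - v)\<close>. The pole
  \<open>z\<close> lies outside the open disc, so the image is a disc or a half-plane.\<close>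

lemma convex_inverse_disc:
  assumes "cmod z \<ge> 1"
  shows "convex {u. cmod (z * u - 1) < cmod u}"
proof -
  have iff: "cmod (z * u - 1) < cmod u \<longleftrightarrow> ((cmod z)\<^sup>2 - 1) * (cmod u)\<^sup>2 - 2 * Re (z * u) + 1 < 0" for u
  proof -
    have "(cmod (z * u - 1))\<^sup>2 - (cmod u)\<^sup>2 = ((cmod z)\<^sup>2 - 1) * (cmod u)\<^sup>2 - 2 * Re (z * u) + 1"
      unfolding cmod_power2 by simp algebra
    moreover have "cmod (z * u - 1) < cmod u \<longleftrightarrow> (cmod (z * u - 1))\<^sup>2 < (cmod u)\<^sup>2"
      by (simp add: power_mono_iff linorder_not_le [symmetric])
    ultimately show ?thesis
      by linarith
  qed
  have c: "(cmod z)\<^sup>2 - 1 \<ge> 0"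
    using assms by simp
  show ?thesis
  proof (rule convexI)
    fix u v :: complex and s t :: real
    assume uv: "u \<in> {u. cmod (z * u - 1) < cmod u}" "v \<in> {u. cmod (z * u - 1) < cmod u}"
      and st: "0 \<le> s" "0 \<le> t" "s + t = 1"
    define h where "h = (\<lambda>u. ((cmod z)\<^sup>2 - 1) * (cmod u)\<^sup>2 - 2 * Re (z * u) + 1)"
    have t: "t = 1 - s"
      using st by simp
    \<comment> \<open>The last term is the convexity defect of the squared modulus; its coefficient
      in \<open>h\<close> is \<open>|z|^2 - 1\<close>, which is nonnegative, so \<open>h\<close> is
      convex.\<close>
    have norm: "(cmod (s *\<^sub>R u + t *\<^sub>R v))\<^sup>2 = s * (cmod u)\<^sup>2 + t * (cmod v)\<^sup>2 - s * t * (cmod (u - v))\<^sup>2"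
      unfolding cmod_power2 t by simp algebra
    have Re: "Re (z * (s *\<^sub>R u + t *\<^sub>R v)) = s * Re (z * u) + t * Re (z * v)"
      by (simp add: algebra_simps)
    have "c * (s * U + t * V - s * t * D) - 2 * (s * X + t * Y) + 1
        = s * (c * U - 2 * X + 1) + t * (c * V - 2 * Y + 1) - c * (s * t * D)" for c U V D X Y :: real
      unfolding t by algebra
    then have "h (s *\<^sub>R u + t *\<^sub>R v) = s * h u + t * h v - ((cmod z)\<^sup>2 - 1) * (s * t * (cmod (u - v))\<^sup>2)"
      unfolding h_def norm Re .
    also have "\<dots> \<le> s * h u + t * h v"
      using c st by simp
    also have "\<dots> < 0"
    proof -
      have "h u < 0" "h v < 0"
        using uv by (auto simp: iff h_def)
      then show ?thesis
        using st by (smt (verit) mult_nonneg_nonpos mult_pos_neg)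
    qed
    finally show "s *\<^sub>R u + t *\<^sub>R v \<in> {u. cmod (z * u - 1) < cmod u}"
      by (simp add: iff h_def)
  qed
qed

text \<open>Here \<open>u\<close> is the mean of the numbers \<open>1 / (z - w)\<close> over the zeros \<open>w\<close>, that is,
  \<open>u = 1 / (z - v)\<close> for some \<open>v\<close> in the open unit disc.\<close>

lemma log_deriv_mean:
  assumes "p \<noteq> 0" "\<And>w. poly p w = 0 \<Longrightarrow> cmod w < 1" "cmod z \<ge> 1"
  shows "\<exists>u. cmod (z * u - 1) < cmod u \<and>
    poly (pderiv p) z = of_nat (degree p) * u * poly p z"
  using assms(1,2)
proof (induction rule: complex_poly_root_induct)
  case (const c)
  \<comment> \<open>The degree is 0, so any admissible \<open>u\<close> serves; \<open>1 / z\<close>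
    corresponds to \<open>v = 0\<close>.\<close>
  have "cmod (z * (1 / z) - 1) < cmod (1 / z)"
    using \<open>cmod z \<ge> 1\<close> by auto
  then show ?case
    by (intro exI[of _ "1 / z"]) (auto simp: pderiv_pCons)
next
  case (root w q)
  then obtain u where u: "cmod (z * u - 1) < cmod u"
    "poly (pderiv q) z = of_nat (degree q) * u * poly q z"
    by auto
  have w: "cmod w < 1"
    using root.prems[of w] by auto
  with \<open>cmod z \<ge> 1\<close> have zw: "z - w \<noteq> 0"
    by auto
  define m where "m = real (degree q)"
  \<comment> \<open>The mean over \<open>m\<close> zeros is updated by the term
    \<open>1 / (z - w)\<close> of the new zero.\<close>
  define v where "v = (m / (m + 1)) *\<^sub>R u + (1 / (m + 1)) *\<^sub>R (1 / (z - w))"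
  have m: "m \<ge> 0"
    by (simp add: m_def)
  have "z * (1 / (z - w)) - 1 = w / (z - w)"
    using zw by (simp add: field_simps)
  then have "cmod (z * (1 / (z - w)) - 1) < cmod (1 / (z - w))"
    using w zw by (simp add: norm_divide divide_strict_right_mono)
  then have "v \<in> {u. cmod (z * u - 1) < cmod u}"
    unfolding v_def using u m
    by (intro convexD[OF convex_inverse_disc[OF \<open>cmod z \<ge> 1\<close>]]) (auto simp: field_simps)
  moreover have "poly (pderiv ([:-w, 1:] * q)) z
      = of_nat (degree ([:-w, 1:] * q)) * v * poly ([:-w, 1:] * q) z"
  proof -
    have m1: "complex_of_real (m + 1) \<noteq> 0"
      unfolding of_real_eq_0_iff using m by linarith
    have "of_real (m + 1) * v = of_real m * u + 1 / (z - w)"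
      unfolding v_def scaleR_conv_of_real of_real_divide using m1
      by (simp add: distrib_left del: of_real_add)
    then have "of_real (m + 1) * v * (z - w) = of_real m * u * (z - w) + 1"
      using zw by (simp add: distrib_right)
    then have "of_real (m + 1) * v * ((z - w) * poly q z)
        = (of_real m * u * (z - w) + 1) * poly q z"
      by (metis mult.assoc)
    moreover have "poly (pderiv ([:-w, 1:] * q)) z = (of_real m * u * (z - w) + 1) * poly q z"
      unfolding pderiv_mult by (simp add: pderiv_pCons u m_def algebra_simps)
    moreover have "of_nat (degree ([:-w, 1:] * q)) = complex_of_real (m + 1)"
      unfolding degree_linear_mult[OF root.hyps(1)] m_def by simp
    moreover have "poly ([:-w, 1:] * q) z = (z - w) * poly q z"
      by (simp add: algebra_simps)
    ultimately show ?thesis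
      by metis
  qed
  ultimately show ?case
    by blast
qed

text \<open>For nonzero \<open>a\<close> the operator is \<open>- a\<close> times the polar
  derivative with pole \<open>- 1 / a\<close>, a point outside the open disc. In terms of the mean
  \<open>u\<close>, a zero would force \<open>u = - a * (z * u - 1)\<close>, hence
  \<open>|u| \<le> |z * u - 1|\<close>.\<close>

lemma smirnov_nonzero:
  assumes "degree p = n" "n \<ge> 1" "\<And>w. poly p w = 0 \<Longrightarrow> cmod w < 1"
    and "cmod z \<ge> 1" "cmod a \<le> 1"
  shows "poly (smirnov n a p) z \<noteq> 0"
proof
  assume zero: "poly (smirnov n a p) z = 0"
  have "p \<noteq> 0"
    using assms by auto
  then obtain u where u: "cmod (z * u - 1) < cmod u"
    "poly (pderiv p) z = of_nat n * u * poly p z"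
    using log_deriv_mean[of p z] assms by auto
  have "poly p z \<noteq> 0"
    using assms(3)[of z] assms(4) by auto
  moreover have "of_nat n * poly p z * ((1 + a * z) * u - a) = 0"
    using zero by (simp add: poly_smirnov u algebra_simps)
  ultimately have "(1 + a * z) * u - a = 0"
    using \<open>n \<ge> 1\<close> by simp
  then have "u = - a * (z * u - 1)"
    by algebra
  then have "cmod u = cmod a * cmod (z * u - 1)"
    by (metis norm_minus_cancel norm_mult)
  also have "\<dots> \<le> cmod (z * u - 1)"
    using assms by (simp add: mult_left_le_one_le)
  finally show False
    using u by simp
qed

section \<open>The combined operator and the zeros of its inner polynomial\<close>

text \<open>Separated from the Smirnov operator because its zeros have to be located before
  \<open>smirnov_nonzero\<close> can be applied to it.\<close>

definition dilate_comb :: "real \<Rightarrow> complex \<Rightarrow> complex poly \<Rightarrow> complex poly" where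
  "dilate_comb R g P = dilate R P + smult g P"

lemma dilate_add: "dilate R (P + Q) = dilate R P + dilate R Q"
  by (simp add: dilate_def pcompose_add)

lemma dilate_smult: "dilate R (smult c P) = smult c (dilate R P)"
  by (simp add: dilate_def pcompose_smult)

lemma coeff_dilate: "coeff (dilate R P) i = of_real R ^ i * coeff P i"
  by (simp add: dilate_def coeff_pcompose_linear)

lemma smirnov_add: "smirnov n a (P + Q) = smirnov n a P + smirnov n a Q"
  by (simp add: smirnov_def pderiv_add algebra_simps smult_add_right)

lemma smirnov_smult: "smirnov n a (smult c P) = smult c (smirnov n a P)"
  unfolding smirnov_def pderiv_smult mult_smult_right smult_diff_right
  by (simp add: mult.commute)

definition smirnov_comb :: "nat \<Rightarrow> complex \<Rightarrow> real \<Rightarrow> complex \<Rightarrow> complex poly \<Rightarrow> complex \<Rightarrow> complex"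
  where "smirnov_comb n a R g P z = poly (smirnov n a (dilate_comb R g P)) z"

lemma smirnov_comb_eq:
  "smirnov_comb n a R g P z = poly (smirnov n a (dilate R P)) z + g * poly (smirnov n a P) z"
  by (simp add: smirnov_comb_def dilate_comb_def smirnov_add smirnov_smult)

lemma smirnov_comb_add:
  "smirnov_comb n a R g (P + Q) z = smirnov_comb n a R g P z + smirnov_comb n a R g Q z"
  by (simp add: smirnov_comb_eq dilate_add smirnov_add algebra_simps)

lemma smirnov_comb_smult:
  "smirnov_comb n a R g (smult c P) z = c * smirnov_comb n a R g P z"
  by (simp add: smirnov_comb_eq dilate_smult smirnov_smult algebra_simps)

lemma dilate_1 [simp]: "dilate 1 P = P"
  by (rule poly_eqI) (simp add: coeff_dilate)

lemma dilate_comb_zeros: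
  assumes "degree p = n" "n \<ge> 1" "\<And>w. poly p w = 0 \<Longrightarrow> cmod w < 1"
    and "R > 1" "cmod g \<le> ((R + 1) / 2) ^ n"
  shows "degree (dilate_comb R g p) = n"
    and "poly (dilate_comb R g p) w = 0 \<Longrightarrow> cmod w < 1"
proof -
  have p: "p \<noteq> 0"
    using assms by auto
  \<comment> \<open>The leading coefficient of the combination is \<open>R ^ n + g\<close> times
    that of \<open>p\<close>, and \<open>|g| < R ^ n\<close> prevents cancellation.\<close>
  have "((R + 1) / 2) ^ n < R ^ n"
    using assms by (intro power_strict_mono) auto
  then have "complex_of_real R ^ n + g \<noteq> 0"
    using assms by (smt (verit) add_eq_0_iff norm_minus_cancel norm_of_real norm_power)
  then have "coeff (dilate_comb R g p) n \<noteq> 0"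
    using p assms(1) by (auto simp: dilate_comb_def coeff_dilate ring_distribs [symmetric])
  moreover have "degree (dilate_comb R g p) \<le> n"
    using assms(1) by (intro degree_le) (auto simp: dilate_comb_def coeff_dilate coeff_eq_0)
  ultimately show "degree (dilate_comb R g p) = n"
    by (meson le_antisym le_degree)
  assume w: "poly (dilate_comb R g p) w = 0"
  show "cmod w < 1"
  proof (rule ccontr)
    assume "\<not> cmod w < 1"
    then have "((R + 1) / 2) ^ n * cmod (poly p w) < cmod (poly p (of_real R * w))"
      using cmod_dilate_ge(2)[of p w R] p assms by force
    moreover have "poly p (of_real R * w) = - (g * poly p w)"
      using w by (simp add: dilate_comb_def poly_dilate eq_neg_iff_add_eq_0)
    then have "cmod (poly p (of_real R * w)) = cmod g * cmod (poly p w)"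
      by (simp add: norm_mult)
    moreover have "\<dots> \<le> ((R + 1) / 2) ^ n * cmod (poly p w)"
      using assms by (intro mult_right_mono) auto
    ultimately show False
      by linarith
  qed
qed

section \<open>Reciprocal polynomials and perturbation of zeros\<close>

lemma degree_conj_recip_le: "degree (conj_recip n P) \<le> n"
  unfolding conj_recip_def by (intro degree_sum_le) (auto intro: order_trans[OF degree_monom_le])

lemma coeff_conj_recip: "i \<le> n \<Longrightarrow> coeff (conj_recip n P) i = cnj (coeff P (n - i))"
  by (simp add: conj_recip_def coeff_sum if_distrib cong: if_cong)

lemma cmod_conj_recip:
  assumes "degree P \<le> n" "cmod z = 1"
  shows "cmod (poly (conj_recip n P) z) = cmod (poly P z)"
proof -
  have "z * cnj z = 1"
    using assms by (simp add: complex_norm_square [symmetric])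
  moreover from this have "cnj z \<noteq> 0"
    by auto
  ultimately have "1 / cnj z = z"
    by (simp add: field_simps)
  then show ?thesis
    using assms by (subst poly_conj_recip) (auto simp: norm_mult norm_power)
qed

lemma quotient_maximum_modulus:
  fixes f g :: "complex poly"
  assumes "\<And>z. cmod z \<le> 1 \<Longrightarrow> poly g z \<noteq> 0"
    and "\<And>z. cmod z = 1 \<Longrightarrow> cmod (poly f z) \<le> cmod (poly g z)"
    and "cmod z \<le> 1"
  shows "cmod (poly f z) \<le> cmod (poly g z)"
proof -
  let ?q = "\<lambda>z. poly f z / poly g z"
  have "cmod (?q z) \<le> 1"
  proof (rule maximum_modulus_frontier[where S = "cball 0 1" and f = ?q])
    show "?q holomorphic_on interior (cball 0 1)"
      using assms(1) by (intro holomorphic_intros) auto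
    show "continuous_on (closure (cball 0 1)) ?q"
      using assms(1) by (intro continuous_intros) auto
    show "cmod (?q w) \<le> 1" if "w \<in> frontier (cball 0 1)" for w
      using that assms(1)[of w] assms(2)[of w] by (simp add: norm_divide)
  qed (use assms in auto)
  then show ?thesis
    using assms(1)[of z] assms(3) by (simp add: norm_divide)
qed

text \<open>Nonzero points of the closed disc are reflected to points with modulus at least 1, where
  \<open>G\<close> has no zeros; at 0 the value is the conjugate of the leading coefficient.\<close>

lemma conj_recip_nonzero:
  assumes "degree G = n" "\<And>w. poly G w = 0 \<Longrightarrow> cmod w < 1" "G \<noteq> 0" "cmod z \<le> 1"
  shows "poly (conj_recip n G) z \<noteq> 0"
proof (cases "z = 0")
  case True
  then show ?thesis
    using assms by (auto simp: poly_0_coeff_0 coeff_conj_recip)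
next
  case False
  then have "cmod (1 / cnj z) \<ge> 1"
    using assms by (simp add: norm_divide)
  then have "poly G (1 / cnj z) \<noteq> 0"
    using assms(2)[of "1 / cnj z"] by auto
  then show ?thesis
    using False assms by (simp add: poly_conj_recip)
qed

text \<open>Rouche's theorem for the exterior of the disc, obtained from the maximum modulus
  principle by reflecting in the circle.\<close>

lemma perturbed_zeros_in_disc:
  assumes "degree G = n" "G \<noteq> 0" "\<And>w. poly G w = 0 \<Longrightarrow> cmod w < 1"
    and "degree F \<le> n" "\<And>w. cmod w = 1 \<Longrightarrow> cmod (poly F w) \<le> cmod (poly G w)"
    and "cmod \<mu> < 1"
  shows "degree (G - smult \<mu> F) = n"
    and "poly (G - smult \<mu> F) w = 0 \<Longrightarrow> cmod w < 1"
proof -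
  have nz: "poly (conj_recip n G) z \<noteq> 0" if "cmod z \<le> 1" for z
    by (rule conj_recip_nonzero[OF assms(1) _ assms(2) that]) (rule assms(3))
  have le: "cmod (poly (conj_recip n F) z) \<le> cmod (poly (conj_recip n G) z)" if "cmod z \<le> 1" for z
  proof (rule quotient_maximum_modulus[OF nz _ that])
    fix w :: complex
    assume "cmod w = 1"
    then show "cmod (poly (conj_recip n F) w) \<le> cmod (poly (conj_recip n G) w)"
      using assms(1,4,5) by (simp add: cmod_conj_recip)
  qed
  have less: "cmod \<mu> * cmod (poly (conj_recip n F) z) < cmod (poly (conj_recip n G) z)"
    if "cmod z \<le> 1" for z
  proof -
    have "cmod \<mu> * cmod (poly (conj_recip n F) z) \<le> cmod \<mu> * cmod (poly (conj_recip n G) z)"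
      using le[OF that] by (intro mult_left_mono) auto
    also have "\<dots> < cmod (poly (conj_recip n G) z)"
      using nz[OF that] assms by simp
    finally show ?thesis .
  qed
  \<comment> \<open>The value of a reciprocal at 0 carries the behaviour at infinity, so the degree
    does not drop.\<close>
  have "cmod \<mu> * cmod (coeff F n) < cmod (coeff G n)"
    using less[of 0] by (simp add: poly_0_coeff_0 coeff_conj_recip)
  then have "coeff (G - smult \<mu> F) n \<noteq> 0"
    by (auto simp: norm_mult)
  moreover have "degree (G - smult \<mu> F) \<le> n"
    using assms by (intro degree_diff_le) auto
  ultimately show "degree (G - smult \<mu> F) = n"
    by (meson le_antisym le_degree)
  assume w: "poly (G - smult \<mu> F) w = 0"
  show "cmod w < 1"
  proof (rule ccontr)
    assume "\<not> cmod w < 1"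
    then have w1: "cmod w \<ge> 1" "w \<noteq> 0"
      by auto
    then have "cmod \<mu> * cmod (poly (conj_recip n F) (1 / cnj w)) < cmod (poly (conj_recip n G) (1 / cnj w))"
      by (intro less) (simp add: norm_divide)
    then have "cmod (1 / cnj w ^ n) * (cmod \<mu> * cmod (poly F w)) < cmod (1 / cnj w ^ n) * cmod (poly G w)"
      using w1 assms by (simp add: poly_conj_recip norm_mult norm_power norm_divide power_one_over)
    then have "cmod \<mu> * cmod (poly F w) < cmod (poly G w)"
      using w1 by (simp add: norm_divide divide_less_cancel)
    then show False
      using w by (auto simp: norm_mult)
  qed
qed

section \<open>Comparison principle for the combined operator\<close>

lemma smirnov_comb_mono:
  assumes "degree G = n" "n \<ge> 1" "\<And>w. poly G w = 0 \<Longrightarrow> cmod w < 1"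
    and "degree F \<le> n" "\<And>w. cmod w = 1 \<Longrightarrow> cmod (poly F w) \<le> cmod (poly G w)"
    and "cmod a \<le> 1" "R \<ge> 1" "cmod g \<le> ((R + 1) / 2) ^ n" "cmod z \<ge> 1"
  shows "cmod (smirnov_comb n a R g F z) \<le> cmod (smirnov_comb n a R g G z)"
proof (rule ccontr)
  let ?L = "\<lambda>P. smirnov_comb n a R g P z"
  assume "\<not> ?thesis"
  then have less: "cmod (?L G) < cmod (?L F)"
    by simp
  then have F: "?L F \<noteq> 0"
    by auto
  define \<mu> where "\<mu> = ?L G / ?L F"
  have \<mu>: "cmod \<mu> < 1"
    using less F by (simp add: \<mu>_def norm_divide)
  define H where "H = G - smult \<mu> F"
  have "G \<noteq> 0"
    using assms by auto
  note H = perturbed_zeros_in_disc[OF assms(1) \<open>G \<noteq> 0\<close> assms(3-5) \<mu>, folded H_def]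
  have "H = G + smult (- \<mu>) F"
    by (simp add: H_def)
  then have "?L H = ?L G + - \<mu> * ?L F"
    by (simp only: smirnov_comb_add smirnov_comb_smult)
  then have zero: "?L H = 0"
    using F by (simp add: \<mu>_def)
  show False
  proof (cases "R = 1")
    \<comment> \<open>There is no strict growth for \<open>R = 1\<close>, and the operator is just
      \<open>1 + g\<close> times the Smirnov operator. The value \<open>g = -1\<close> is possible,
      but it would make \<open>?L F\<close> vanish.\<close>
    case True
    then have "?L P = (1 + g) * poly (smirnov n a P) z" for P
      by (simp add: smirnov_comb_eq algebra_simps)
    moreover have "poly (smirnov n a H) z \<noteq> 0"
      using H assms by (intro smirnov_nonzero) auto
    ultimately show False
      using zero F by auto
  next
    case False
    then have "R > 1"
      using assms by simp
    then have "poly (smirnov n a (dilate_comb R g H)) z \<noteq> 0"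
      using dilate_comb_zeros[OF H(1) assms(2) H(2) _ assms(8)] assms
      by (intro smirnov_nonzero) auto
    then show False
      using zero by (simp add: smirnov_comb_def)
  qed
qed

section \<open>The inequality for a polynomial and its reciprocal\<close>

text \<open>Rotate \<open>B\<close> to point opposite to \<open>A\<close>. The zero cases are
  separate because \<open>sgn 0 = 0\<close> is not unimodular.\<close>

lemma exists_opposing_rotation:
  fixes A B :: complex
  assumes "cmod A \<le> cmod B"
  shows "\<exists>\<omega>. cmod \<omega> = 1 \<and> cmod (A + \<omega> * B) = cmod B - cmod A"
proof (cases "A = 0 \<or> B = 0")
  case True
  then show ?thesis
    using assms by (intro exI[of _ 1]) auto
next
  case False
  define \<omega> where "\<omega> = - (sgn A / sgn B)"
  have "B = sgn B * of_real (cmod B)" "A = sgn A * of_real (cmod A)"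
    by (simp_all add: sgn_eq)
  moreover have "sgn B \<noteq> 0"
    using False by (simp add: sgn_zero_iff)
  ultimately have "\<omega> * B = - sgn A * of_real (cmod B)"
    unfolding \<omega>_def by (metis minus_mult_left mult.assoc nonzero_eq_divide_eq)
  with \<open>A = _\<close> have "A + \<omega> * B = sgn A * of_real (cmod A - cmod B)"
    by (simp add: algebra_simps)
  then have "cmod (A + \<omega> * B) = cmod B - cmod A"
    using False assms by (simp add: norm_mult norm_sgn del: of_real_diff)
  moreover have "cmod \<omega> = 1"
    using False by (simp add: \<omega>_def norm_divide norm_sgn)
  ultimately show ?thesis
    by blast
qed

lemma cmod_poly_le_circle_max:
  assumes "cmod z \<le> 1"
  shows "cmod (poly P z) \<le> circle_max P"
proof (rule maximum_modulus_frontier[where S = "cball 0 1" and f = "poly P"])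
  show "cmod (poly P w) \<le> circle_max P" if "w \<in> frontier (cball 0 1)" for w
    using that by (intro circle_max_attained(2)) auto
qed (use assms in \<open>auto intro!: holomorphic_intros continuous_intros\<close>)

text \<open>A nonzero polynomial cannot vanish on the whole disc, which is infinite. Positivity
  makes \<open>t * circle_max P\<close> strictly larger than the maximum when
  \<open>t > 1\<close>.\<close>

lemma circle_max_pos:
  assumes "P \<noteq> 0"
  shows "circle_max P > 0"
proof -
  have "infinite (cball (0::complex) 1)"
    using uncountable_cball[of 1 "0::complex"] by (auto dest: countable_finite)
  then have "\<not> cball 0 1 \<subseteq> {w. poly P w = 0}"
    using poly_roots_finite[OF assms] finite_subset by blast
  then obtain w where "cmod w \<le> 1" "poly P w \<noteq> 0"
    unfolding subset_iff mem_cball_0 by blast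
  then show ?thesis
    using cmod_poly_le_circle_max[of w P] by (smt (verit) zero_less_norm_iff)
qed

lemma conj_recip_add_const:
  "conj_recip n (P + [:c:]) = conj_recip n P + smult (cnj c) (monom 1 n)"
proof (rule poly_eqI)
  fix i
  show "coeff (conj_recip n (P + [:c:])) i
      = coeff (conj_recip n P + smult (cnj c) (monom 1 n)) i"
  proof (cases "i \<le> n")
    case True
    then show ?thesis
      by (auto simp: coeff_conj_recip coeff_pCons split: nat.splits)
  next
    case False
    then show ?thesis
      using degree_conj_recip_le[of n "P + [:c:]"] degree_conj_recip_le[of n P]
      by (simp add: coeff_eq_0)
  qed
qed

lemma smirnov_comb_sum_le_scaled:
  assumes "degree P = n" "n \<ge> 1" "cmod a \<le> 1" "R \<ge> 1"
    and "cmod g \<le> ((R + 1) / 2) ^ n" "cmod z \<ge> 1" "t > 1"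
  shows "cmod (smirnov_comb n a R g P z) + cmod (smirnov_comb n a R g (conj_recip n P) z)
    \<le> t * (circle_max P *
        (cmod (smirnov_comb n a R g (monom 1 n) z) + cmod (smirnov_comb n a R g 1 z)))"
proof -
  let ?L = "\<lambda>P. smirnov_comb n a R g P z"
  let ?M = "circle_max P"
  let ?Q = "conj_recip n P"
  have M: "?M > 0"
    using assms by (intro circle_max_pos) auto
  \<comment> \<open>This comparison supplies the hypothesis of
    \<open>exists_opposing_rotation\<close>: the monomial term dominates
    \<open>?L ?Q\<close>.\<close>
  have "cmod (?L ?Q) \<le> cmod (?L (smult (of_real ?M) (monom 1 n)))"
    using assms M circle_max_attained(2)
    by (intro smirnov_comb_mono)
       (auto simp: degree_conj_recip_le cmod_conj_recip poly_monom norm_mult norm_power degree_monom_eq)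
  also have "\<dots> \<le> cmod (of_real (t * ?M) * ?L (monom 1 n))"
    using M \<open>t > 1\<close> by (simp add: smirnov_comb_smult norm_mult mult_right_mono)
  finally have "cmod (?L ?Q) \<le> cmod (of_real (t * ?M) * ?L (monom 1 n))" .
  then obtain \<omega> where \<omega>: "cmod \<omega> = 1"
    "cmod (?L ?Q + \<omega> * (of_real (t * ?M) * ?L (monom 1 n)))
      = cmod (of_real (t * ?M) * ?L (monom 1 n)) - cmod (?L ?Q)"
    using exists_opposing_rotation by blast
  \<comment> \<open>Taking the reciprocal conjugates \<open>c\<close>, so the rotation
    \<open>\<omega>\<close> reappears in \<open>?L G\<close>.\<close>
  define c where "c = cnj \<omega> * of_real (t * ?M)"
  have c: "cmod c = t * ?M"
    using \<omega> M \<open>t > 1\<close> by (simp add: c_def norm_mult)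
  define F where "F = P + [:c:]"
  define G where "G = conj_recip n F"
  have degF: "degree F \<le> n"
    using assms by (auto simp: F_def intro: degree_add_le)
  have F: "poly F w \<noteq> 0" if "cmod w \<le> 1" for w
  proof
    assume "poly F w = 0"
    then have "cmod (poly P w) = t * ?M"
      using c by (simp add: F_def add_eq_0_iff)
    moreover have "?M < t * ?M"
      using M \<open>t > 1\<close> by simp
    ultimately show False
      using cmod_poly_le_circle_max[OF that, of P] by simp
  qed
  \<comment> \<open>The leading coefficient of \<open>G\<close> is the conjugate of \<open>F\<close>
    at 0.\<close>
  have "coeff G n \<noteq> 0"
    using F[of 0] by (simp add: G_def coeff_conj_recip poly_0_coeff_0)
  then have degG: "degree G = n"
    by (metis G_def degree_conj_recip_le le_antisym le_degree)
  have G: "cmod w < 1" if "poly G w = 0" for w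
  proof (rule ccontr)
    assume "\<not> cmod w < 1"
    then have "w \<noteq> 0" "cmod (1 / cnj w) \<le> 1"
      by (auto simp: norm_divide divide_le_eq_1)
    then show False
      using that F[of "1 / cnj w"] degF by (simp add: G_def poly_conj_recip)
  qed
  have "cmod (?L F) \<le> cmod (?L G)"
    using assms degG degF G by (intro smirnov_comb_mono) (auto simp: G_def cmod_conj_recip)
  moreover have "?L G = ?L ?Q + \<omega> * (of_real (t * ?M) * ?L (monom 1 n))"
    by (simp add: G_def F_def conj_recip_add_const smirnov_comb_add smirnov_comb_smult c_def)
  moreover have "?L F = ?L P + c * ?L 1"
    by (simp add: F_def smirnov_comb_add flip: smirnov_comb_smult)
  moreover have "cmod (?L P) \<le> cmod (?L P + c * ?L 1) + cmod (c * ?L 1)"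
    by (metis add_diff_cancel_right' norm_triangle_ineq4)
  ultimately have "cmod (?L P) + cmod (?L ?Q)
      \<le> cmod (of_real (t * ?M) * ?L (monom 1 n)) + cmod (c * ?L 1)"
    using \<omega> by simp
  also have "\<dots> = t * (?M * (cmod (?L (monom 1 n)) + cmod (?L 1)))"
    using M \<open>t > 1\<close> c by (simp add: norm_mult algebra_simps)
  finally show ?thesis .
qed

lemma smirnov_comb_sum_le:
  assumes "degree P = n" "n \<ge> 1" "cmod a \<le> 1" "R \<ge> 1"
    and "cmod g \<le> ((R + 1) / 2) ^ n" "cmod z \<ge> 1"
  shows "cmod (smirnov_comb n a R g P z) + cmod (smirnov_comb n a R g (conj_recip n P) z)
    \<le> circle_max P *
        (cmod (smirnov_comb n a R g (monom 1 n) z) + cmod (smirnov_comb n a R g 1 z))"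
    (is "?x \<le> ?C")
proof (rule tendsto_lowerbound)
  show "((\<lambda>t. t * ?C) \<longlongrightarrow> ?C) (at_right 1)"
    by (auto intro!: tendsto_eq_intros)
  show "\<forall>\<^sub>F t in at_right 1. ?x \<le> t * ?C"
    using eventually_at_right_less[of "1::real"]
    by eventually_elim (rule smirnov_comb_sum_le_scaled[OF assms])
qed auto

section \<open>Explicit values, equality for monomials, and the theorem\<close>

lemma smirnov_comb_monom:
  "smirnov_comb n a R g (monom c n) z
    = c * (of_real (R ^ n) + g) * poly (smirnov n a (monom 1 n)) z"
proof -
  have "monom c n = smult c (monom 1 n)"
    by (simp add: smult_monom)
  moreover have "dilate R (monom 1 n) = smult (of_real (R ^ n)) (monom 1 n)"
    by (rule poly_eqI) (simp add: coeff_dilate)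
  ultimately show ?thesis
    by (simp add: smirnov_comb_smult) (simp add: smirnov_comb_eq smirnov_smult algebra_simps)
qed

lemma smirnov_comb_const:
  "smirnov_comb n a R g [:c:] z = - (c * (1 + g) * (of_nat n * a))"
  by (simp add: smirnov_comb_eq poly_smirnov poly_dilate dilate_def pderiv_pCons algebra_simps)

text \<open>For a monomial of degree \<open>n\<close> the reciprocal is constant, so the two
  summands on the left become exactly the two terms of the bound.\<close>

lemma conj_recip_monom: "conj_recip n (monom c n) = [:cnj c:]"
proof (rule poly_eqI)
  fix i
  show "coeff (conj_recip n (monom c n)) i = coeff [:cnj c:] i"
  proof (cases "i \<le> n")
    case True
    then show ?thesis
      by (auto simp: coeff_conj_recip coeff_pCons split: nat.splits)
  next
    case False
    then show ?thesis
      using degree_conj_recip_le[of n "monom c n"]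
      by (auto simp: coeff_eq_0 coeff_pCons split: nat.splits)
  qed
qed

lemma circle_max_monom: "circle_max (monom c n) = cmod c"
proof -
  obtain w where "cmod w = 1" "cmod (poly (monom c n) w) = circle_max (monom c n)"
    using circle_max_attained(1) by blast
  then show ?thesis
    by (simp add: poly_monom norm_mult norm_power)
qed

theorem theorem2p2:
  fixes n :: nat and a \<alpha> \<beta> z :: complex and R :: real
  assumes "n \<ge> 1"
    and "cmod a \<le> 1"
    and "cmod \<alpha> \<le> 1" and "cmod \<beta> \<le> 1"
    and "R \<ge> 1"
    and "cmod z \<ge> 1"
  shows "(\<forall>P :: complex poly. degree P = n \<longrightarrow>
        cmod (poly (smirnov n a (dilate R P)) z - \<alpha> * poly (smirnov n a P) z
              + \<beta> * complex_of_real (((R + 1) / 2) ^ n - cmod \<alpha>) * poly (smirnov n a P) z)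
        + cmod (poly (smirnov n a (dilate R (conj_recip n P))) z - \<alpha> * poly (smirnov n a (conj_recip n P)) z
              + \<beta> * complex_of_real (((R + 1) / 2) ^ n - cmod \<alpha>) * poly (smirnov n a (conj_recip n P)) z)
      \<le> (cmod (complex_of_real (R ^ n) - \<alpha> + \<beta> * complex_of_real (((R + 1) / 2) ^ n - cmod \<alpha>))
              * cmod (poly (smirnov n a (monom 1 n)) z)
            + cmod (1 - \<alpha> + \<beta> * complex_of_real (((R + 1) / 2) ^ n - cmod \<alpha>)) * real n * cmod a)
          * circle_max P) \<and>
    (\<forall>c :: complex. c \<noteq> 0 \<longrightarrow>
        cmod (poly (smirnov n a (dilate R (monom c n))) z - \<alpha> * poly (smirnov n a (monom c n)) z
              + \<beta> * complex_of_real (((R + 1) / 2) ^ n - cmod \<alpha>) * poly (smirnov n a (monom c n)) z)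
        + cmod (poly (smirnov n a (dilate R (conj_recip n (monom c n)))) z - \<alpha> * poly (smirnov n a (conj_recip n (monom c n))) z
              + \<beta> * complex_of_real (((R + 1) / 2) ^ n - cmod \<alpha>) * poly (smirnov n a (conj_recip n (monom c n))) z)
      = (cmod (complex_of_real (R ^ n) - \<alpha> + \<beta> * complex_of_real (((R + 1) / 2) ^ n - cmod \<alpha>))
              * cmod (poly (smirnov n a (monom 1 n)) z)
            + cmod (1 - \<alpha> + \<beta> * complex_of_real (((R + 1) / 2) ^ n - cmod \<alpha>)) * real n * cmod a)
          * circle_max (monom c n))"
proof -
  let ?k = "((R + 1) / 2) ^ n - cmod \<alpha>"
  define g where "g = \<beta> * complex_of_real ?k - \<alpha>"
  have "((R + 1) / 2) ^ n \<ge> 1"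
    using \<open>R \<ge> 1\<close> by (intro one_le_power) auto
  then have k: "?k \<ge> 0"
    using \<open>cmod \<alpha> \<le> 1\<close> by linarith
  \<comment> \<open>Subtracting \<open>cmod \<alpha>\<close> in the factor of \<open>\<beta>\<close>
    compensates the contribution of \<open>\<alpha>\<close>, so the bound required by the comparison
    comes out exactly.\<close>
  have "cmod g \<le> cmod \<beta> * ?k + cmod \<alpha>"
    unfolding g_def by (rule order_trans[OF norm_triangle_ineq4]) (use k in \<open>simp add: norm_mult del: of_real_diff\<close>)
  also have "\<dots> \<le> ?k + cmod \<alpha>"
    by (intro add_right_mono mult_left_le_one_le k \<open>cmod \<beta> \<le> 1\<close>) simp
  finally have g: "cmod g \<le> ((R + 1) / 2) ^ n"
    by simp
  let ?L = "\<lambda>P. smirnov_comb n a R g P z"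
  have L: "poly (smirnov n a (dilate R P)) z - \<alpha> * poly (smirnov n a P) z
      + \<beta> * complex_of_real ?k * poly (smirnov n a P) z = ?L P" for P
    by (simp add: smirnov_comb_eq g_def algebra_simps)
  have coeffs: "complex_of_real (R ^ n) - \<alpha> + \<beta> * complex_of_real ?k = complex_of_real (R ^ n) + g"
    "1 - \<alpha> + \<beta> * complex_of_real ?k = 1 + g"
    by (simp_all add: g_def)
  have monom: "cmod (?L (monom c n))
      = cmod c * (cmod (complex_of_real (R ^ n) + g) * cmod (poly (smirnov n a (monom 1 n)) z))" for c
    unfolding smirnov_comb_monom norm_mult by simp
  have const: "cmod (?L [:c:]) = cmod c * (cmod (1 + g) * real n * cmod a)" for c
    unfolding smirnov_comb_const norm_minus_cancel norm_mult by simp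
  show ?thesis
    unfolding L coeffs
  proof (intro conjI allI impI)
    fix P :: "complex poly"
    assume "degree P = n"
    from smirnov_comb_sum_le[OF this assms(1,2,5) g assms(6)] monom[of 1] const[of 1]
    show "cmod (?L P) + cmod (?L (conj_recip n P))
        \<le> (cmod (complex_of_real (R ^ n) + g) * cmod (poly (smirnov n a (monom 1 n)) z)
            + cmod (1 + g) * real n * cmod a) * circle_max P"
      by (simp add: one_pCons mult.commute del: of_real_power)
  next
    fix c :: complex
    show "cmod (?L (monom c n)) + cmod (?L (conj_recip n (monom c n)))
        = (cmod (complex_of_real (R ^ n) + g) * cmod (poly (smirnov n a (monom 1 n)) z)
            + cmod (1 + g) * real n * cmod a) * circle_max (monom c n)"
      unfolding conj_recip_monom monom const circle_max_monom by (simp add: algebra_simps)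
  qed
qed

end
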